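(* For any $n$-dimensional infinite constellation $S$ with NLD $\delta$, transmitted over the real scalar fast fading channel described in the context, the average error probability satisfies $$P_e(S)\ge \Pr\left\{\|\mathbf z\|^2\ge e^{-2\delta}\left(\frac{\det(\mathbf H)}{V_n}\right)^{2/n}\right\},$$ where $V_n=\frac{\pi^{n/2}}{\frac n2\Gamma(\frac n2)}$ is the volume of the unit ball in $\mathbb R^n$, $\mathbf z\sim N(0,\sigma^2I_n)$ and $\mathbf H=\mathrm{diag}(H_1,\dots,H_n)$ are independent, and the probability is over both.
   Context: Channel: $Y_i=H_iX_i+Z_i$ where $\{H_i\}$ are i.i.d. nonnegative fading coefficients with $E H_i^2=1$ whose PDF is a regular fading distribution (there is $\alpha>0$ with $f(h)\propto h^{\alpha-1}$ for all small $h>0$; a standing assumption of the paper), $\{Z_i\}$ i.i.d. $N(0,\sigma^2)$, all independent, receiver knows $\mathbf H$. An IC is a countable $S\subset\mathbb R^n$; $\mathrm{Cb}(a)=\{|x_i|<a/2\}$; density $\gamma=\limsup_a|S\cap\mathrm{Cb}(a)|/a^n$; NLD $\delta=\frac1n\ln\gamma$. $P_e(S)=E\{\limsup_{a\to\infty}\frac{1}{M(S_{\mathbf H},a)}\sum_{s_{rc}\in S_{\mathbf H}\cap\mathbf H\mathrm{Cb}(a)}\Pr\{s_{rc}+\mathbf z\notin W(s_{rc})\mid\mathbf H\}\}$ where $S_{\mathbf H}=\{\mathbf Hs:s\in S\}$, $M(S_{\mathbf H},a)=|S_{\mathbf H}\cap\mathbf H\mathrm{Cb}(a)|$, and $W(s_{rc})$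 is the Voronoi cell of $s_{rc}$ in $S_{\mathbf H}$. *)

theory Defs
  imports "HOL-Probability.Probability"
begin

(* Vectors of R^n are functions 'n => real on a finite index type 'n, n = CARD('n). *)

definition sqnorm :: "('n::finite \<Rightarrow> real) \<Rightarrow> real" where
  "sqnorm x = (\<Sum>i\<in>UNIV. (x i)\<^sup>2)"

definition Cb :: "real \<Rightarrow> ('n::finite \<Rightarrow> real) set" where
  "Cb a = {x. \<forall>i. \<bar>x i\<bar> < a / 2}"

definition ecard :: "'a set \<Rightarrow> ereal" where
  "ecard A = (if finite A then ereal (real (card A)) else \<infinity>)"

definition ic_density :: "('n::finite \<Rightarrow> real) set \<Rightarrow> ereal" where
  "ic_density S = Limsup at_top (\<lambda>a::real. ecard (S \<inter> Cb a) / ereal (a ^ CARD('n)))"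

definition NLD :: "('n::finite \<Rightarrow> real) set \<Rightarrow> real" where
  "NLD S = ln (real_of_ereal (ic_density S)) / real CARD('n)"

text \<open>Componentwise multiplication by the diagonal fading matrix H = diag(h).\<close>
definition hmul :: "('n \<Rightarrow> real) \<Rightarrow> ('n \<Rightarrow> real) \<Rightarrow> ('n \<Rightarrow> real)" where
  "hmul h x = (\<lambda>i. h i * x i)"

definition received_IC :: "('n \<Rightarrow> real) \<Rightarrow> ('n \<Rightarrow> real) set \<Rightarrow> ('n \<Rightarrow> real) set" where
  "received_IC h S = hmul h ` S"

definition voronoi :: "('n::finite \<Rightarrow> real) set \<Rightarrow> ('n \<Rightarrow> real) \<Rightarrow> ('n \<Rightarrow> real) set" where
  "voronoi T s = {y. \<forall>t\<in>T. sqnorm (\<lambda>i. y i - s i) \<le> sqnorm (\<lambda>i. y i - t i)}"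

definition noise_meas :: "real \<Rightarrow> ('n::finite \<Rightarrow> real) measure" where
  "noise_meas \<sigma> = PiM UNIV (\<lambda>i. density lborel (normal_density 0 \<sigma>))"

definition fading_meas :: "(real \<Rightarrow> real) \<Rightarrow> ('n::finite \<Rightarrow> real) measure" where
  "fading_meas f = PiM UNIV (\<lambda>i. density lborel f)"

definition regular_fading_pdf :: "(real \<Rightarrow> real) \<Rightarrow> bool" where
  "regular_fading_pdf f \<longleftrightarrow>
     f \<in> borel_measurable borel \<and>
     (\<forall>h. 0 \<le> f h) \<and> (\<forall>h<0. f h = 0) \<and>
     (\<integral>\<^sup>+ h. ennreal (f h) \<partial>lborel) = 1 \<and>
     (\<integral>\<^sup>+ h. ennreal (h\<^sup>2 * f h) \<partial>lborel) = 1 \<and>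
     (\<exists>\<alpha>>0. \<exists>c>0. \<exists>\<epsilon>>0. \<forall>h. 0 < h \<and> h < \<epsilon> \<longrightarrow> f h = c * h powr (\<alpha> - 1))"

definition point_err :: "real \<Rightarrow> ('n::finite \<Rightarrow> real) set \<Rightarrow> ('n \<Rightarrow> real) \<Rightarrow> real" where
  "point_err \<sigma> T s = measure (noise_meas \<sigma>) {z. (\<lambda>i. s i + z i) \<notin> voronoi T s}"

definition cond_err :: "real \<Rightarrow> ('n::finite \<Rightarrow> real) set \<Rightarrow> ('n \<Rightarrow> real) \<Rightarrow> ennreal" where
  "cond_err \<sigma> S h = Limsup at_top (\<lambda>a::real.
     let A = received_IC h S \<inter> hmul h ` Cb a
     in ennreal ((\<Sum>s\<in>A. point_err \<sigma> (received_IC h S) s) / real (card A)))"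

definition avg_err :: "real \<Rightarrow> (real \<Rightarrow> real) \<Rightarrow> ('n::finite \<Rightarrow> real) set \<Rightarrow> ennreal" where
  "avg_err \<sigma> f S = (\<integral>\<^sup>+ h. cond_err \<sigma> S h \<partial>fading_meas f)"

definition V_ball :: "nat \<Rightarrow> real" where
  "V_ball n = pi powr (real n / 2) / ((real n / 2) * Gamma (real n / 2))"

end

theory Submission
  imports Defs
begin

text \<open>
  Given positive fading coefficients, put \<open>D = det H\<close> and let \<open>R\<close> be the radius of a ball of volume
  \<open>D / \<gamma>\<close>. As the Gaussian density \<open>g\<close> is radially decreasing, a cell \<open>E\<close> around the origin and the
  ball \<open>B\<close> of radius \<open>R\<close> satisfy \<open>N(E) \<le> N(B) + g(R) (vol E - vol B)\<close>. This bound is linear in the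
  volume, so it can be averaged over the cells without any convexity argument. Truncated to a cube of
  side \<open>2\<rho>\<close> around their centres, the Voronoi cells of the points in \<open>H Cb(a)\<close> overlap in null sets and
  stay in a box of volume \<open>D a^n (1 + o(1))\<close>; along values of \<open>a\<close> that approach the upper density
  \<open>\<gamma>\<close>, their average volume is therefore at most \<open>D / \<gamma> + o(1)\<close>, while the truncation costs only the
  noise probability outside the cube, which vanishes as \<open>\<rho> \<rightarrow> \<infinity>\<close>.
\<close>

section \<open>Lebesgue measure on R^n and the Gaussian noise law\<close>

abbreviation lborel_PiM :: "('n::finite \<Rightarrow> real) measure" where
  "lborel_PiM \<equiv> PiM UNIV (\<lambda>_. lborel)"

definition gauss_density :: "real \<Rightarrow> ('n::finite \<Rightarrow> real) \<Rightarrow> real" where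
  "gauss_density \<sigma> z = (\<Prod>i\<in>UNIV. normal_density 0 \<sigma> (z i))"

interpretation lborel_PiM: product_sigma_finite "\<lambda>_::'n::finite. lborel :: real measure"
  by standard

lemma space_lborel_PiM [simp]: "space (lborel_PiM :: ('n::finite \<Rightarrow> real) measure) = UNIV"
  by (simp add: space_PiM)

lemma sets_noise_meas [simp, measurable_cong]: "sets (noise_meas \<sigma>) = sets lborel_PiM"
  unfolding noise_meas_def by (intro sets_PiM_cong) auto

lemma sets_fading_meas [simp, measurable_cong]: "sets (fading_meas f) = sets lborel_PiM"
  unfolding fading_meas_def by (intro sets_PiM_cong) auto

lemma space_noise_meas [simp]: "space (noise_meas \<sigma>) = UNIV"
  by (simp add: noise_meas_def space_PiM)

lemma borel_measurable_sqnorm [measurable]: "sqnorm \<in> borel_measurable lborel_PiM"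
  unfolding sqnorm_def by measurable

lemma sets_sqnorm_ball [measurable]: "{z :: 'n::finite \<Rightarrow> real. sqnorm z < c} \<in> sets lborel_PiM"
proof -
  have "{z \<in> space lborel_PiM. sqnorm z < c} \<in> sets lborel_PiM" by measurable
  then show ?thesis by simp
qed

lemma borel_measurable_gauss_density [measurable]: "gauss_density \<sigma> \<in> borel_measurable lborel_PiM"
  unfolding gauss_density_def by measurable

lemma prob_space_noise_meas: "\<sigma> > 0 \<Longrightarrow> prob_space (noise_meas \<sigma>)"
  unfolding noise_meas_def by (intro prob_space_PiM prob_space_normal_density)

text \<open>In this form the density is seen to depend on \<open>z\<close> only through
  \<open>sqnorm z\<close> and to decrease with it, which is why balls are the best decision
  cells.\<close>

lemma gauss_density_eq: "gauss_density \<sigma> (z :: 'n::finite \<Rightarrow> real) =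
    (1 / sqrt (2 * pi * \<sigma>\<^sup>2)) ^ CARD('n) * exp (- sqnorm z / (2 * \<sigma>\<^sup>2))"
  by (simp add: gauss_density_def normal_density_def sqnorm_def prod_dividef exp_sum[symmetric]
      sum_divide_distrib sum_negf power_divide)

lemma gauss_density_nonneg: "gauss_density \<sigma> z \<ge> 0"
  by (simp add: gauss_density_def prod_nonneg)

lemma gauss_density_antimono:
  fixes x y :: "'n::finite \<Rightarrow> real"
  assumes "sqnorm x \<le> sqnorm y"
  shows "gauss_density \<sigma> y \<le> gauss_density \<sigma> x"
  unfolding gauss_density_eq using assms by (intro mult_left_mono) (auto intro: divide_right_mono)

text \<open>A product measure is determined by its values on boxes. On a box both the density and
  the indicator factor over the coordinates, so the integral becomes a product of one-dimensional
  ones.\<close>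

lemma noise_meas_eq_density:
  assumes "\<sigma> > 0"
  shows "noise_meas \<sigma> = density lborel_PiM (\<lambda>z::'n::finite \<Rightarrow> real. ennreal (gauss_density \<sigma> z))"
proof -
  interpret N: product_sigma_finite "\<lambda>_::'n. density lborel (normal_density 0 \<sigma>)"
    using assms by (intro product_sigma_finite.intro prob_space_imp_sigma_finite prob_space_normal_density)
  have "density lborel_PiM (\<lambda>z::'n \<Rightarrow> real. ennreal (gauss_density \<sigma> z))
      = PiM UNIV (\<lambda>_. density lborel (normal_density 0 \<sigma>))"
  proof (rule N.PiM_eqI)
    fix A :: "'n \<Rightarrow> real set"
    assume "\<And>i. i \<in> UNIV \<Longrightarrow> A i \<in> sets (density lborel (normal_density 0 \<sigma>))"
    then have [measurable]: "A i \<in> sets borel" for i by simp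
    have "emeasure (density lborel_PiM (\<lambda>z::'n \<Rightarrow> real. ennreal (gauss_density \<sigma> z))) (Pi\<^sub>E UNIV A)
       = (\<integral>\<^sup>+z. ennreal (gauss_density \<sigma> z) * indicator (Pi\<^sub>E UNIV A) z \<partial>lborel_PiM)"
      by (intro emeasure_density sets_PiM_I_finite) auto
    also have "\<dots> = (\<integral>\<^sup>+z. (\<Prod>i\<in>UNIV. ennreal (normal_density 0 \<sigma> (z i)) * indicator (A i) (z i)) \<partial>lborel_PiM)"
    proof (intro nn_integral_cong)
      fix z :: "'n \<Rightarrow> real"
      have "indicator (Pi\<^sub>E UNIV A) z = (\<Prod>i\<in>UNIV. indicator (A i) (z i) :: ennreal)"
        by (auto simp: indicator_def PiE_def Pi_def)
      then show "ennreal (gauss_density \<sigma> z) * indicator (Pi\<^sub>E UNIV A) z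
          = (\<Prod>i\<in>UNIV. ennreal (normal_density 0 \<sigma> (z i)) * indicator (A i) (z i))"
        by (simp add: gauss_density_def prod.distrib prod_ennreal)
    qed
    also have "\<dots> = (\<Prod>i\<in>UNIV. \<integral>\<^sup>+x. ennreal (normal_density 0 \<sigma> x) * indicator (A i) x \<partial>lborel)"
      by (intro lborel_PiM.product_nn_integral_prod) auto
    also have "\<dots> = (\<Prod>i\<in>UNIV. emeasure (density lborel (normal_density 0 \<sigma>)) (A i))"
      by (intro prod.cong refl) (simp add: emeasure_density)
    finally show "emeasure (density lborel_PiM (\<lambda>z::'n \<Rightarrow> real. ennreal (gauss_density \<sigma> z))) (Pi\<^sub>E UNIV A)
        = (\<Prod>i\<in>UNIV. emeasure (density lborel (normal_density 0 \<sigma>)) (A i))" .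
  qed (auto intro!: sets_PiM_cong)
  then show ?thesis by (simp add: noise_meas_def)
qed

section \<open>Translations and bisecting hyperplanes\<close>

lemma measurable_translate [measurable]:
  "(\<lambda>z i. s i + z i) \<in> measurable lborel_PiM (lborel_PiM :: ('n::finite \<Rightarrow> real) measure)"
  by (intro measurable_PiM_single') auto

lemma distr_lborel_PiM_translate:
  fixes s :: "'n::finite \<Rightarrow> real"
  shows "distr lborel_PiM lborel_PiM (\<lambda>z i. s i + z i) = lborel_PiM"
proof (rule lborel_PiM.PiM_eqI)
  fix A :: "'n \<Rightarrow> real set"
  assume "\<And>i. i \<in> UNIV \<Longrightarrow> A i \<in> sets lborel"
  then have A[measurable]: "A i \<in> sets borel" for i by simp
  have "emeasure (distr lborel_PiM lborel_PiM (\<lambda>z i. s i + z i)) (Pi\<^sub>E UNIV A)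
     = emeasure lborel_PiM ((\<lambda>z i. s i + z i) -` Pi\<^sub>E UNIV A)"
    by (subst emeasure_distr) (auto intro!: sets_PiM_I_finite)
  also have "(\<lambda>z i. s i + z i) -` Pi\<^sub>E UNIV A = Pi\<^sub>E UNIV (\<lambda>i. (\<lambda>x. s i + x) -` A i)"
    by (auto simp: PiE_def Pi_def)
  also have "emeasure lborel_PiM \<dots> = (\<Prod>i\<in>UNIV. emeasure lborel ((\<lambda>x. s i + x) -` A i))"
    using measurable_sets_borel[OF _ A, of "(+) (s _)"] by (intro lborel_PiM.emeasure_PiM) auto
  also have "\<dots> = (\<Prod>i\<in>UNIV. emeasure lborel (A i))"
  proof (intro prod.cong refl)
    fix i
    have "emeasure (distr lborel borel ((+) (s i))) (A i) = emeasure lborel ((\<lambda>x. s i + x) -` A i)"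
      by (subst emeasure_distr) auto
    then show "emeasure lborel ((\<lambda>x. s i + x) -` A i) = emeasure lborel (A i)"
      by (simp add: lborel_distr_plus)
  qed
  finally show "emeasure (distr lborel_PiM lborel_PiM (\<lambda>z i. s i + z i)) (Pi\<^sub>E UNIV A)
     = (\<Prod>i\<in>UNIV. emeasure lborel (A i))" .
qed auto

lemma measure_lborel_PiM_translate:
  fixes s :: "'n::finite \<Rightarrow> real"
  assumes "E \<in> sets lborel_PiM"
  shows "measure lborel_PiM {z. (\<lambda>i. s i + z i) \<in> E} = measure lborel_PiM E"
proof -
  have "measure lborel_PiM E = measure (distr lborel_PiM lborel_PiM (\<lambda>z i. s i + z i)) E"
    by (simp add: distr_lborel_PiM_translate)
  also have "\<dots> = measure lborel_PiM {z. (\<lambda>i. s i + z i) \<in> E}"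
    using assms by (subst measure_distr) (auto simp: vimage_def)
  finally show ?thesis by simp
qed

text \<open>The quadratic terms in \<open>y\<close> cancel, so the equidistance condition is affine
  in \<open>y\<close> with a nonzero coefficient at any \<open>k\<close> where \<open>s\<close> and
  \<open>t\<close> differ. Each line in direction \<open>k\<close> thus meets the bisector in at
  most one point, and Fubini makes it a null set.\<close>

lemma AE_lborel_PiM_not_bisector:
  fixes s t :: "'n::finite \<Rightarrow> real"
  assumes "s \<noteq> t"
  shows "AE y in lborel_PiM. sqnorm (\<lambda>i. y i - s i) \<noteq> sqnorm (\<lambda>i. y i - t i)"
proof -
  obtain k where k: "s k \<noteq> t k" using assms by auto
  define P where "P = {y. sqnorm (\<lambda>i. y i - s i) = sqnorm (\<lambda>i. y i - t i)}"
  have U: "insert k (UNIV - {k}) = (UNIV :: 'n set)" by auto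
  have P[measurable]: "P \<in> sets lborel_PiM"
  proof -
    have "{y \<in> space lborel_PiM. sqnorm (\<lambda>i. y i - s i) = sqnorm (\<lambda>i. y i - t i)} \<in> sets lborel_PiM"
      unfolding sqnorm_def by measurable
    then show ?thesis by (simp add: P_def)
  qed
  have sep: "sqnorm (\<lambda>i. (x(k := u)) i - v i) = (u - v k)\<^sup>2 + (\<Sum>i\<in>UNIV-{k}. (x i - v i)\<^sup>2)"
    for x v :: "'n \<Rightarrow> real" and u
  proof -
    have "sqnorm (\<lambda>i. (x(k := u)) i - v i) = (\<Sum>i\<in>insert k (UNIV - {k}). ((x(k := u)) i - v i)\<^sup>2)"
      by (simp add: sqnorm_def U)
    also have "\<dots> = (u - v k)\<^sup>2 + (\<Sum>i\<in>UNIV-{k}. ((x(k := u)) i - v i)\<^sup>2)"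
      by (subst sum.insert) auto
    also have "(\<Sum>i\<in>UNIV-{k}. ((x(k := u)) i - v i)\<^sup>2) = (\<Sum>i\<in>UNIV-{k}. (x i - v i)\<^sup>2)"
      by (intro sum.cong) auto
    finally show ?thesis .
  qed
  have "emeasure lborel_PiM P = (\<integral>\<^sup>+y. indicator P y \<partial>PiM (insert k (UNIV - {k})) (\<lambda>_. lborel))"
    by (simp add: U)
  also have "\<dots> = (\<integral>\<^sup>+x. (\<integral>\<^sup>+u. indicator P (x(k := u)) \<partial>lborel) \<partial>PiM (UNIV - {k}) (\<lambda>_. lborel))"
    by (intro lborel_PiM.product_nn_integral_insert) (auto simp: U)
  also have "\<dots> = 0"
  proof -
    have "(\<integral>\<^sup>+u. indicator P (x(k := u)) \<partial>lborel) = 0" for x :: "'n \<Rightarrow> real"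
    proof -
      \<comment> \<open>The equidistance equation along the line, solved for
        \<open>u * (2 * (t k - s k))\<close>.\<close>
      define c where "c = (\<Sum>i\<in>UNIV-{k}. (x i - t i)\<^sup>2) - (\<Sum>i\<in>UNIV-{k}. (x i - s i)\<^sup>2)
        + (t k)\<^sup>2 - (s k)\<^sup>2"
      have *: "u = c / (2 * (t k - s k))" if "x(k := u) \<in> P" for u
      proof -
        have "(u - s k)\<^sup>2 + (\<Sum>i\<in>UNIV-{k}. (x i - s i)\<^sup>2) = (u - t k)\<^sup>2 + (\<Sum>i\<in>UNIV-{k}. (x i - t i)\<^sup>2)"
          using that unfolding P_def sep[symmetric] by simp
        then have "u * (2 * (t k - s k)) = c"
          by (simp add: c_def power2_eq_square algebra_simps)
        then show ?thesis using k by (simp add: field_simps)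
      qed
      have "(\<integral>\<^sup>+u. indicator P (x(k := u)) \<partial>lborel) \<le> (\<integral>\<^sup>+u. indicator {c / (2 * (t k - s k))} u \<partial>lborel)"
        by (intro nn_integral_mono) (auto simp: indicator_def dest: *)
      then show ?thesis by simp
    qed
    then show ?thesis by simp
  qed
  finally have "P \<in> null_sets lborel_PiM" using P by (simp add: null_sets_def)
  then show ?thesis by (rule AE_I') (auto simp: P_def)
qed

section \<open>Comparison with balls, and their volumes\<close>

text \<open>The density at \<open>w\<close> separates the two regions: it is a lower bound for the
  density on \<open>B\<close> and an upper bound off \<open>B\<close>. Hence \<open>E - B\<close>
  gains at most, and \<open>B - E\<close> loses at least, that value times the volume.
  \<open>E\<close> may have any finite volume, so the bound can be summed over cells of unequal
  size.\<close>

lemma noise_meas_le_ball: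
  fixes E B :: "('n::finite \<Rightarrow> real) set" and w :: "'n \<Rightarrow> real"
  assumes "\<sigma> > 0" and [measurable]: "E \<in> sets lborel_PiM" and "emeasure lborel_PiM E < \<infinity>"
    and B: "B = {z. sqnorm z < sqnorm w}" and "emeasure lborel_PiM B < \<infinity>"
  shows "measure (noise_meas \<sigma>) E
    \<le> measure (noise_meas \<sigma>) B + gauss_density \<sigma> w * (measure lborel_PiM E - measure lborel_PiM B)"
proof -
  interpret N: prob_space "noise_meas \<sigma> :: ('n \<Rightarrow> real) measure"
    by (rule prob_space_noise_meas) fact
  let ?g = "gauss_density \<sigma> w"
  have [measurable]: "B \<in> sets lborel_PiM"
    unfolding B by (rule sets_sqnorm_ball)
  have out: "emeasure (noise_meas \<sigma>) (E - B) \<le> ennreal ?g * emeasure lborel_PiM (E - B)"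
  proof -
    have "emeasure (noise_meas \<sigma>) (E - B) = (\<integral>\<^sup>+z. ennreal (gauss_density \<sigma> z) * indicator (E - B) z \<partial>lborel_PiM)"
      by (simp add: noise_meas_eq_density[OF assms(1)] emeasure_density)
    also have "\<dots> \<le> (\<integral>\<^sup>+z. ennreal ?g * indicator (E - B) z \<partial>lborel_PiM)"
      by (intro nn_integral_mono) (auto simp: indicator_def B not_less intro!: gauss_density_antimono ennreal_leI)
    finally show ?thesis by (simp add: nn_integral_cmult)
  qed
  have inn: "ennreal ?g * emeasure lborel_PiM (B - E) \<le> emeasure (noise_meas \<sigma>) (B - E)"
  proof -
    have "ennreal ?g * emeasure lborel_PiM (B - E) = (\<integral>\<^sup>+z. ennreal ?g * indicator (B - E) z \<partial>lborel_PiM)"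
      by (simp add: nn_integral_cmult)
    also have "\<dots> \<le> (\<integral>\<^sup>+z. ennreal (gauss_density \<sigma> z) * indicator (B - E) z \<partial>lborel_PiM)"
      by (intro nn_integral_mono) (auto simp: indicator_def B not_less intro!: gauss_density_antimono ennreal_leI)
    also have "\<dots> = emeasure (noise_meas \<sigma>) (B - E)"
      by (simp add: noise_meas_eq_density[OF assms(1)] emeasure_density)
    finally show ?thesis .
  qed
  have fm: "E \<in> fmeasurable lborel_PiM" "B \<in> fmeasurable lborel_PiM"
    using assms(2,3,5) \<open>B \<in> sets lborel_PiM\<close> by (auto simp: fmeasurable_def)
  then have fin: "emeasure lborel_PiM (E - B) = measure lborel_PiM (E - B)"
      "emeasure lborel_PiM (B - E) = measure lborel_PiM (B - E)"
    by (auto intro!: emeasure_eq_measure2 fmeasurable.Diff)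
  have out': "measure (noise_meas \<sigma>) (E - B) \<le> ?g * measure lborel_PiM (E - B)"
    using out by (simp add: fin N.emeasure_eq_measure gauss_density_nonneg flip: ennreal_mult)
  have inn': "?g * measure lborel_PiM (B - E) \<le> measure (noise_meas \<sigma>) (B - E)"
    using inn by (simp add: fin N.emeasure_eq_measure gauss_density_nonneg flip: ennreal_mult)
  have split: "measure (noise_meas \<sigma>) E = measure (noise_meas \<sigma>) (E \<inter> B) + measure (noise_meas \<sigma>) (E - B)"
      "measure (noise_meas \<sigma>) B = measure (noise_meas \<sigma>) (E \<inter> B) + measure (noise_meas \<sigma>) (B - E)"
    by (subst N.finite_measure_Union[symmetric]; auto intro!: arg_cong[where f = "measure _"])+
  \<comment> \<open>Expanding the volume of the union in both orders shows that the common part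
    \<open>E \<inter> B\<close> cancels.\<close>
  have diff: "measure lborel_PiM E - measure lborel_PiM B
      = measure lborel_PiM (E - B) - measure lborel_PiM (B - E)"
    using measure_Un2[OF fm] measure_Un2[OF fm(2) fm(1)] by (simp add: Un_commute)
  show ?thesis using out' inn' by (simp add: split diff algebra_simps)
qed


lemma V_ball_eq: "n > 0 \<Longrightarrow> V_ball n = unit_ball_vol (real n)"
  unfolding V_ball_def unit_ball_vol_def
  by (subst Gamma_plus1) (auto simp: field_simps dest: nonpos_Ints_nonpos)

lemma V_ball_pos: "n > 0 \<Longrightarrow> V_ball n > 0"
  by (simp add: V_ball_eq)

lemma emeasure_closed_ball:
  assumes "R > 0"
  shows "emeasure lborel_PiM {z :: 'n::finite \<Rightarrow> real. sqnorm z \<le> R\<^sup>2} = ennreal (V_ball CARD('n) * R ^ CARD('n))"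
proof -
  have "{z :: 'n \<Rightarrow> real. sqnorm z \<le> R\<^sup>2} = {f. sqrt (\<Sum>i\<in>UNIV. (f i)\<^sup>2) \<le> R} \<inter> space lborel_PiM"
    using assms by (auto simp: sqnorm_def sum_nonneg real_sqrt_le_iff')
  then show ?thesis
    using emeasure_cball_aux[of "UNIV :: 'n set" R] assms by (simp add: V_ball_eq)
qed

text \<open>The volume formula at hand is for closed balls, so the open ball is bounded from below
  by the closed balls of radius \<open>r < R\<close> as \<open>r\<close> tends to \<open>R\<close>.
  A lower bound suffices, since the volume of \<open>B\<close> enters
  \<open>noise_meas_le_ball\<close> with a negative sign.\<close>

lemma open_ball_volume:
  assumes "R > 0"
  shows "emeasure lborel_PiM {z :: 'n::finite \<Rightarrow> real. sqnorm z < R\<^sup>2} < \<infinity>"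
    and "V_ball CARD('n) * R ^ CARD('n) \<le> measure lborel_PiM {z :: 'n::finite \<Rightarrow> real. sqnorm z < R\<^sup>2}"
proof -
  let ?B = "{z :: 'n::finite \<Rightarrow> real. sqnorm z < R\<^sup>2}"
  have clos: "{z :: 'n \<Rightarrow> real. sqnorm z \<le> r\<^sup>2} \<in> sets lborel_PiM" for r
  proof -
    have "{z \<in> space (lborel_PiM :: ('n \<Rightarrow> real) measure). sqnorm z \<le> r\<^sup>2} \<in> sets lborel_PiM" by measurable
    then show ?thesis by simp
  qed
  have "emeasure lborel_PiM ?B \<le> emeasure lborel_PiM {z :: 'n \<Rightarrow> real. sqnorm z \<le> R\<^sup>2}"
    by (intro emeasure_mono clos) auto
  also have "\<dots> < \<infinity>"
    using assms by (simp add: emeasure_closed_ball)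
  finally show fin: "emeasure lborel_PiM ?B < \<infinity>" .
  have low: "V_ball CARD('n) * r ^ CARD('n) \<le> measure lborel_PiM ?B" if r: "0 < r" "r < R" for r
  proof -
    have "r\<^sup>2 < R\<^sup>2" using r by (intro power_strict_mono) auto
    then have "emeasure lborel_PiM {z :: 'n \<Rightarrow> real. sqnorm z \<le> r\<^sup>2} \<le> emeasure lborel_PiM ?B"
      by (intro emeasure_mono) auto
    then have "ennreal (V_ball CARD('n) * r ^ CARD('n)) \<le> ennreal (measure lborel_PiM ?B)"
      using r fin by (simp add: emeasure_eq_ennreal_measure flip: emeasure_closed_ball)
    then show ?thesis by simp
  qed
  have "((\<lambda>r. V_ball CARD('n) * r ^ CARD('n)) \<longlongrightarrow> V_ball CARD('n) * R ^ CARD('n)) (at_left R)"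
    by (intro tendsto_intros)
  then show "V_ball CARD('n) * R ^ CARD('n) \<le> measure lborel_PiM ?B"
    by (rule tendsto_upperbound) (use assms low in \<open>auto intro: eventually_at_leftI[of 0]\<close>)
qed

section \<open>Voronoi cells: packing and total error\<close>

lemma sets_voronoi [measurable]:
  fixes T :: "('n::finite \<Rightarrow> real) set"
  assumes "countable T"
  shows "voronoi T s \<in> sets lborel_PiM"
proof -
  have "{y \<in> space lborel_PiM. \<forall>t\<in>T. sqnorm (\<lambda>i. y i - s i) \<le> sqnorm (\<lambda>i. y i - t i)} \<in> sets lborel_PiM"
    by (rule sets.sets_Collect_countable_All'[OF _ assms]) (unfold sqnorm_def, measurable)
  then show ?thesis by (simp add: voronoi_def)
qed

lemma sets_Cb [measurable]: "(Cb a :: ('n::finite \<Rightarrow> real) set) \<in> sets lborel_PiM"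
proof -
  have "{x \<in> space (lborel_PiM :: ('n \<Rightarrow> real) measure). \<forall>i. \<bar>x i\<bar> < a / 2} \<in> sets lborel_PiM"
    by measurable
  then show ?thesis by (simp add: Cb_def)
qed

lemma sets_Compl_Cb [measurable]: "(- Cb a :: ('n::finite \<Rightarrow> real) set) \<in> sets lborel_PiM"
  using sets.compl_sets[OF sets_Cb, of a] by (simp add: Compl_eq_Diff_UNIV)

lemma emeasure_box:
  fixes c :: "'n::finite \<Rightarrow> real"
  assumes "\<And>i. 0 \<le> c i"
  shows "{y. \<forall>i. \<bar>y i\<bar> < c i} \<in> sets lborel_PiM"
    and "emeasure lborel_PiM {y. \<forall>i. \<bar>y i\<bar> < c i} = ennreal (\<Prod>i\<in>UNIV. 2 * c i)"
proof -
  have eq: "{y. \<forall>i. \<bar>y i\<bar> < c i} = Pi\<^sub>E UNIV (\<lambda>i. {- c i<..<c i})"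
    by (auto simp: PiE_def Pi_def abs_less_iff minus_less_iff)
  show "{y. \<forall>i. \<bar>y i\<bar> < c i} \<in> sets lborel_PiM"
    unfolding eq by (intro sets_PiM_I_finite) auto
  have "emeasure lborel_PiM {y. \<forall>i. \<bar>y i\<bar> < c i} = (\<Prod>i\<in>UNIV. emeasure lborel {- c i<..<c i})"
    unfolding eq by (intro lborel_PiM.emeasure_PiM) auto
  also have "\<dots> = (\<Prod>i\<in>UNIV. ennreal (2 * c i))"
    using assms by (intro prod.cong refl) (auto simp: emeasure_lborel_Ioo)
  also have "\<dots> = ennreal (\<Prod>i\<in>UNIV. 2 * c i)"
    using assms by (intro prod_ennreal) auto
  finally show "emeasure lborel_PiM {y. \<forall>i. \<bar>y i\<bar> < c i} = ennreal (\<Prod>i\<in>UNIV. 2 * c i)" .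
qed

text \<open>A Voronoi cell can be unbounded and have infinite volume. The cube, of half-side
  \<open>\<rho>\<close>, makes the volume finite and keeps the cell close to its centre.\<close>

definition truncated_cell :: "real \<Rightarrow> ('n::finite \<Rightarrow> real) set \<Rightarrow> ('n \<Rightarrow> real) \<Rightarrow> ('n \<Rightarrow> real) set" where
  "truncated_cell \<rho> T s = voronoi T s \<inter> {y. (\<lambda>i. y i - s i) \<in> Cb (2 * \<rho>)}"

lemma sets_truncated_cell:
  fixes T :: "('n::finite \<Rightarrow> real) set"
  assumes "countable T"
  shows "truncated_cell \<rho> T s \<in> sets lborel_PiM"
proof -
  have "{y \<in> space (lborel_PiM :: ('n \<Rightarrow> real) measure). \<forall>i. \<bar>y i - s i\<bar> < \<rho>} \<in> sets lborel_PiM"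
    by measurable
  then have "{y. (\<lambda>i. y i - s i) \<in> Cb (2 * \<rho>)} \<in> sets lborel_PiM"
    by (simp add: Cb_def)
  then show ?thesis
    unfolding truncated_cell_def using assms by (intro sets.Int sets_voronoi)
qed

text \<open>A point of two cells is equidistant from their centres, so distinct cells overlap in
  null sets only and their volumes add up to that of the union. Truncation confines the union to the
  box with half-sides \<open>b i + \<rho>\<close>. The half-sides vary with the coordinate because
  fading stretches each axis differently.\<close>

lemma sum_truncated_cells_le:
  fixes T :: "('n::finite \<Rightarrow> real) set"
  assumes "countable T" "finite A" "A \<subseteq> T" "\<rho> > 0"
    and b: "\<And>s i. s \<in> A \<Longrightarrow> \<bar>s i\<bar> < b i" "\<And>i. 0 \<le> b i"
  shows "(\<Sum>s\<in>A. measure lborel_PiM (truncated_cell \<rho> T s))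
      \<le> (\<Prod>i\<in>UNIV. 2 * (b i + \<rho>))"
proof -
  let ?C = "truncated_cell \<rho> T"
  let ?box = "{y. \<forall>i. \<bar>y i\<bar> < b i + \<rho>}"
  note box = emeasure_box[of "\<lambda>i. b i + \<rho>"]
  have c0: "0 \<le> b i + \<rho>" for i using b(2)[of i] \<open>\<rho> > 0\<close> by simp
  have sub: "?C s \<subseteq> ?box" if "s \<in> A" for s
  proof
    fix y assume "y \<in> ?C s"
    then have "\<bar>y i - s i\<bar> < \<rho>" for i by (auto simp: truncated_cell_def Cb_def)
    then have "\<bar>y i\<bar> < b i + \<rho>" for i using b(1)[OF that, of i] by (smt (verit))
    then show "y \<in> ?box" by simp
  qed
  have boxm: "?box \<in> fmeasurable lborel_PiM"
    using box c0 by (auto simp: fmeasurable_def)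
  have Cs: "?C s \<in> sets lborel_PiM" for s
    by (rule sets_truncated_cell) fact
  have Cf: "?C s \<in> fmeasurable lborel_PiM" if "s \<in> A" for s
    using fmeasurableI2[OF boxm sub[OF that] Cs] .
  have "pairwise (\<lambda>s t. AE y in lborel_PiM. y \<notin> ?C s \<or> y \<notin> ?C t) A"
  proof (rule pairwiseI)
    fix s t assume st: "s \<in> A" "t \<in> A" "s \<noteq> t"
    show "AE y in lborel_PiM. y \<notin> ?C s \<or> y \<notin> ?C t"
      using AE_lborel_PiM_not_bisector[OF st(3)]
    proof eventually_elim
      case (elim y)
      moreover have "sqnorm (\<lambda>i. y i - s i) = sqnorm (\<lambda>i. y i - t i)" if "y \<in> ?C s" "y \<in> ?C t"
        using that st \<open>A \<subseteq> T\<close> unfolding truncated_cell_def voronoi_def by (intro antisym) blast+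
      ultimately show ?case by blast
    qed
  qed
  then have "(\<Sum>s\<in>A. measure lborel_PiM (?C s)) = measure lborel_PiM (\<Union>s\<in>A. ?C s)"
    using Cf \<open>finite A\<close> by (intro measure_UNION_AE[symmetric]) auto
  also have "\<dots> \<le> measure lborel_PiM ?box"
    using sub \<open>finite A\<close> by (intro measure_mono_fmeasurable boxm sets.finite_UN Cs) auto
  also have "\<dots> = (\<Prod>i\<in>UNIV. 2 * (b i + \<rho>))"
    unfolding measure_def box(2)[OF c0] by (intro enn2real_ennreal prod_nonneg ballI mult_nonneg_nonneg c0) simp
  finally show ?thesis .
qed

text \<open>Each cell is compared with the ball of radius \<open>R\<close>, and the bounds are
  summed before any volume is estimated. Only the total volume of the truncated cells then matters;
  it has the nonpositive factor \<open>- gauss_density \<sigma> w\<close>, so the packing bound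
  applies.\<close>

lemma sum_point_err_ge:
  fixes T A :: "('n::finite \<Rightarrow> real) set" and w :: "'n \<Rightarrow> real"
  assumes "\<sigma> > 0" "countable T" "finite A" "A \<subseteq> T" "\<rho> > 0" "R > 0" "sqnorm w = R\<^sup>2"
    and b: "\<And>s i. s \<in> A \<Longrightarrow> \<bar>s i\<bar> < b i" "\<And>i. 0 \<le> b i"
  shows "real (card A) * (measure (noise_meas \<sigma>) {z :: 'n \<Rightarrow> real. sqnorm z \<ge> R\<^sup>2}
            - measure (noise_meas \<sigma>) (- Cb (2 * \<rho>) :: ('n \<Rightarrow> real) set)
            + gauss_density \<sigma> w * (V_ball CARD('n) * R ^ CARD('n)))
          - gauss_density \<sigma> w * (\<Prod>i\<in>UNIV. 2 * (b i + \<rho>))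
        \<le> (\<Sum>s\<in>A. point_err \<sigma> T s)"
proof -
  interpret N: prob_space "noise_meas \<sigma> :: ('n \<Rightarrow> real) measure"
    by (rule prob_space_noise_meas) fact
  let ?N = "measure (noise_meas \<sigma> :: ('n \<Rightarrow> real) measure)" and ?L = "measure lborel_PiM"
  let ?g = "gauss_density \<sigma> w" and ?B = "{z :: 'n \<Rightarrow> real. sqnorm z < sqnorm w}"
  let ?v = "V_ball CARD('n) * R ^ CARD('n)"
  let ?tail = "?N (- Cb (2 * \<rho>))"
  \<comment> \<open>\<open>E s\<close> is the truncated cell moved so that its centre is the origin,
    hence a set of noise vectors.\<close>
  define E where "E s = {z. (\<lambda>i. s i + z i) \<in> voronoi T s} \<inter> Cb (2 * \<rho>)" for s
  have out: "?N {z. sqnorm z \<ge> R\<^sup>2} = 1 - ?N ?B"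
  proof -
    have "?N (space (noise_meas \<sigma>) - ?B) = 1 - ?N ?B" by (intro N.prob_compl) simp
    also have "space (noise_meas \<sigma>) - ?B = {z. sqnorm z \<ge> R\<^sup>2}" by (auto simp: assms not_less)
    finally show ?thesis .
  qed
  have point: "1 - ?N ?B - ?tail + ?g * ?v
      - ?g * ?L (truncated_cell \<rho> T s) \<le> point_err \<sigma> T s" for s
  proof -
    let ?D = "{z. (\<lambda>i. s i + z i) \<in> voronoi T s}"
    have D[measurable]: "?D \<in> sets lborel_PiM"
      using measurable_sets[OF measurable_translate sets_voronoi[OF \<open>countable T\<close>], of s s]
      by (simp add: vimage_def)
    have E[measurable]: "E s \<in> sets lborel_PiM" by (simp add: E_def)
    have "emeasure lborel_PiM (E s) \<le> emeasure lborel_PiM (Cb (2 * \<rho>) :: ('n \<Rightarrow> real) set)"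
      by (intro emeasure_mono) (auto simp: E_def)
    also have "\<dots> < \<infinity>"
      using emeasure_box(2)[of "\<lambda>_::'n. \<rho>"] \<open>\<rho> > 0\<close> by (simp add: Cb_def)
    finally have Efin: "emeasure lborel_PiM (E s) < \<infinity>" .
    \<comment> \<open>A correct decision needs noise in \<open>E s\<close> or outside the cube; the
      latter costs at most \<open>?tail\<close>.\<close>
    have "?N ?D \<le> ?N (E s \<union> (- Cb (2 * \<rho>)))"
      by (intro N.finite_measure_mono) (auto simp: E_def)
    also have "\<dots> \<le> ?N (E s) + ?tail"
      by (intro measure_subadditive) auto
    also have "?N (E s) \<le> ?N ?B + ?g * (?L (E s) - ?L ?B)"
      using open_ball_volume(1)[OF \<open>R > 0\<close>, where 'n='n] assms
      by (intro noise_meas_le_ball Efin) auto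
    also have "\<dots> \<le> ?N ?B + ?g * (?L (E s) - ?v)"
      using open_ball_volume(2)[OF \<open>R > 0\<close>, where 'n='n] assms
      by (intro add_left_mono mult_left_mono) (auto simp: gauss_density_nonneg)
    also have "?L (E s) = ?L (truncated_cell \<rho> T s)"
    proof -
      have "truncated_cell \<rho> T s \<in> sets lborel_PiM"
        by (rule sets_truncated_cell) fact
      from measure_lborel_PiM_translate[OF this, of s] show ?thesis
        by (simp add: E_def truncated_cell_def Collect_conj_eq[symmetric] Int_def)
    qed
    finally have "?N ?D \<le> ?N ?B + ?g * (?L (truncated_cell \<rho> T s) - ?v) + ?tail"
      by simp
    moreover have "point_err \<sigma> T s = 1 - ?N ?D"
    proof -
      have "?N (space (noise_meas \<sigma>) - ?D) = 1 - ?N ?D" by (intro N.prob_compl) simp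
      then show ?thesis by (simp add: point_err_def set_diff_eq)
    qed
    ultimately show ?thesis by (simp add: algebra_simps)
  qed
  have "real (card A) * (1 - ?N ?B - ?tail + ?g * ?v) - ?g * (\<Prod>i\<in>UNIV. 2 * (b i + \<rho>))
     \<le> real (card A) * (1 - ?N ?B - ?tail + ?g * ?v)
      - ?g * (\<Sum>s\<in>A. ?L (truncated_cell \<rho> T s))"
    using assms by (intro diff_left_mono mult_left_mono sum_truncated_cells_le) (auto simp: gauss_density_nonneg)
  also have "\<dots> = (\<Sum>s\<in>A. 1 - ?N ?B - ?tail + ?g * ?v
      - ?g * ?L (truncated_cell \<rho> T s))"
    by (simp add: sum_subtractf sum_distrib_left)
  also have "\<dots> \<le> (\<Sum>s\<in>A. point_err \<sigma> T s)"
    by (intro sum_mono point)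
  finally show ?thesis by (simp only: out)
qed

section \<open>Noise tail and the bound for fixed fading coefficients\<close>

lemma noise_meas_tail:
  assumes "\<sigma> > 0" "\<epsilon> > 0"
  obtains \<rho> where "\<rho> > 0" "measure (noise_meas \<sigma>) (- Cb (2 * \<rho>) :: ('n::finite \<Rightarrow> real) set) < \<epsilon>"
proof -
  interpret N: prob_space "noise_meas \<sigma> :: ('n \<Rightarrow> real) measure"
    by (rule prob_space_noise_meas) fact
  let ?F = "\<lambda>k. - Cb (2 * real k) :: ('n \<Rightarrow> real) set"
  have "z \<notin> (\<Inter>k. ?F k)" for z
  proof -
    obtain k :: nat where "Max (range (\<lambda>i. \<bar>z i\<bar>)) < real k" using reals_Archimedean2 by blast
    then have "\<forall>i. \<bar>z i\<bar> < real k" by (subst (asm) Max_less_iff) auto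
    then show ?thesis by (auto simp: Cb_def)
  qed
  then have "(\<Inter>k. ?F k) = {}" by blast
  \<comment> \<open>Continuity from above along the decreasing complements of the growing
    cubes.\<close>
  moreover have "(\<lambda>k. measure (noise_meas \<sigma>) (?F k)) \<longlonglongrightarrow> measure (noise_meas \<sigma>) (\<Inter>k. ?F k)"
  proof (intro N.finite_Lim_measure_decseq)
    show "decseq ?F"
      unfolding decseq_def Cb_def by (auto intro: order_less_le_trans)
  qed auto
  ultimately have "\<forall>\<^sub>F k in sequentially. measure (noise_meas \<sigma>) (?F k) < \<epsilon>"
    using \<open>\<epsilon> > 0\<close> by (auto intro: order_tendstoD)
  then have "\<forall>\<^sub>F k in sequentially. 0 < k \<and> measure (noise_meas \<sigma>) (?F k) < \<epsilon>"
    by (intro eventually_conj eventually_gt_at_top)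
  then obtain k where "k > 0" "measure (noise_meas \<sigma>) (?F k) < \<epsilon>"
    using eventually_happens'[OF sequentially_bot] by blast
  then show ?thesis by (intro that[of "real k"]) auto
qed

lemma inj_hmul: "(\<And>i. h i > 0) \<Longrightarrow> inj (hmul h)"
  by (auto simp: inj_def hmul_def fun_eq_iff) (metis less_irrefl)

text \<open>If the limsup of the averages were below \<open>p - \<epsilon>\<close>, the averages
  would eventually be below it. The density, also a limsup, comes close to \<open>\<gamma>\<close>
  only for arbitrarily large \<open>a\<close>, not for all of them; one such \<open>a\<close> beyond
  the threshold gives the contradiction.\<close>

lemma cond_err_ge:
  fixes S :: "('n::finite \<Rightarrow> real) set"
  assumes "\<sigma> > 0" "countable S" "0 < ic_density S" "ic_density S < \<infinity>" "\<And>i. h i > 0"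
  shows "emeasure (noise_meas \<sigma>) {z :: 'n \<Rightarrow> real. sqnorm z \<ge> exp (-2 * NLD S) *
               ((\<Prod>i\<in>UNIV. h i) / V_ball CARD('n)) powr (2 / real CARD('n))}
         \<le> cond_err \<sigma> S h"
proof -
  interpret N: prob_space "noise_meas \<sigma> :: ('n \<Rightarrow> real) measure"
    by (rule prob_space_noise_meas) fact
  let ?n = "CARD('n)" and ?V = "V_ball CARD('n)"
  define \<gamma> where "\<gamma> = real_of_ereal (ic_density S)"
  have ic: "ic_density S = ereal \<gamma>"
    using assms(3,4) by (cases "ic_density S") (simp_all add: \<gamma>_def)
  have "\<gamma> > 0"
    using assms(3) by (simp add: ic)
  have inj: "inj (hmul h)" by (rule inj_hmul) fact
  define D where "D = (\<Prod>i\<in>UNIV. h i)"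
  have "D > 0" unfolding D_def using assms by (intro prod_pos) auto
  have V: "?V > 0" by (intro V_ball_pos) simp
  \<comment> \<open>\<open>R\<close> is the radius of the ball whose volume is
    \<open>D / \<gamma>\<close>, the received volume per point; its square is the threshold of the
    claim (\<open>R2\<close>).\<close>
  define R where "R = (D / ?V / \<gamma>) powr (1 / real ?n)"
  have "R > 0" using \<open>D > 0\<close> V \<open>\<gamma> > 0\<close> by (simp add: R_def)
  have Rn: "?V * R ^ ?n = D / \<gamma>"
    using \<open>D > 0\<close> V \<open>\<gamma> > 0\<close> by (simp add: R_def powr_realpow[symmetric] powr_powr)
  have R2: "exp (-2 * NLD S) * (D / ?V) powr (2 / real ?n) = R\<^sup>2"
  proof -
    have "R\<^sup>2 = (D / ?V / \<gamma>) powr (2 / real ?n)"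
      using \<open>D > 0\<close> V \<open>\<gamma> > 0\<close> by (simp add: R_def powr_realpow[symmetric] powr_powr)
    also have "\<dots> = (D / ?V) powr (2 / real ?n) * \<gamma> powr (- (2 / real ?n))"
      using \<open>D > 0\<close> V \<open>\<gamma> > 0\<close> by (simp add: powr_divide powr_mult powr_minus_divide)
    also have "\<gamma> powr (- (2 / real ?n)) = exp (-2 * NLD S)"
      using \<open>\<gamma> > 0\<close> by (simp add: powr_def NLD_def \<gamma>_def[symmetric])
    finally show ?thesis by simp
  qed
  define p where "p = measure (noise_meas \<sigma>) {z :: 'n \<Rightarrow> real. sqnorm z \<ge> R\<^sup>2}"
  \<comment> \<open>Any vector of norm \<open>R\<close> would do: it serves to name the value of the
    density on the sphere.\<close>
  define w :: "'n \<Rightarrow> real" where "w = (\<lambda>i. if i = (SOME k. True) then R else 0)"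
  have w: "sqnorm w = R\<^sup>2"
    by (simp add: sqnorm_def w_def if_distrib[of "\<lambda>x. x\<^sup>2"] cong: if_cong)
  define g where "g = gauss_density \<sigma> w"
  have "g \<ge> 0" by (simp add: g_def gauss_density_nonneg)
  let ?avg = "\<lambda>a. let A = received_IC h S \<inter> hmul h ` Cb a
     in ennreal ((\<Sum>s\<in>A. point_err \<sigma> (received_IC h S) s) / real (card A))"
  let ?dens = "\<lambda>a. ecard (S \<inter> Cb a) / ereal (a ^ ?n)"
  have main: "ennreal (p - \<epsilon>) \<le> cond_err \<sigma> S h" if "\<epsilon> > 0" for \<epsilon>
  proof (rule ccontr)
    assume "\<not> ennreal (p - \<epsilon>) \<le> cond_err \<sigma> S h"
    then have "Limsup at_top ?avg < ennreal (p - \<epsilon>)"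
      by (simp add: cond_err_def not_le)
    then have small: "\<forall>\<^sub>F a in at_top. ?avg a < ennreal (p - \<epsilon>)"
      by (rule Limsup_lessD)
    obtain \<rho> where "\<rho> > 0" and \<rho>: "measure (noise_meas \<sigma>) (- Cb (2 * \<rho>) :: ('n \<Rightarrow> real) set) < \<epsilon> / 2"
      using noise_meas_tail[of \<sigma> "\<epsilon> / 2"] \<open>\<sigma> > 0\<close> \<open>\<epsilon> > 0\<close> by auto
    \<comment> \<open>Half of \<open>\<epsilon>\<close> pays for the noise tail, the other half for
      an excess volume \<open>\<eta>\<close> per point, weighted by \<open>g\<close>. Adding 1 to
      \<open>g\<close> keeps the denominator positive.\<close>
    define \<eta> where "\<eta> = \<epsilon> / (2 * (g + 1))"
    have "\<eta> > 0" and g\<eta>: "g * \<eta> \<le> \<epsilon> / 2"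
      using \<open>g \<ge> 0\<close> \<open>\<epsilon> > 0\<close> by (auto simp: \<eta>_def field_simps)
    \<comment> \<open>Chosen so that \<open>D / \<gamma>' = D / \<gamma> + \<eta> / 2\<close>: the
      other \<open>\<eta> / 2\<close> is left for the enlargement of the box by
      \<open>\<rho>\<close>, which becomes negligible relative to \<open>a\<close>
      (\<open>vol\<close>).\<close>
    define \<gamma>' where "\<gamma>' = D / (D / \<gamma> + \<eta> / 2)"
    have "D / \<gamma> > 0" using \<open>D > 0\<close> \<open>\<gamma> > 0\<close> by simp
    have "\<gamma>' > 0" using \<open>D > 0\<close> \<open>D / \<gamma> > 0\<close> \<open>\<eta> > 0\<close> by (simp add: \<gamma>'_def add_pos_pos)
    have "\<gamma>' < D / (D / \<gamma>)"
      unfolding \<gamma>'_def using \<open>D > 0\<close> \<open>D / \<gamma> > 0\<close> \<open>\<eta> > 0\<close> by (intro divide_strict_left_mono mult_pos_pos add_pos_pos) simp_all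
    then have "\<gamma>' < \<gamma>" using \<open>D > 0\<close> by simp
    have D\<gamma>': "D / \<gamma>' < D / \<gamma> + \<eta>" using \<open>D > 0\<close> \<open>\<eta> > 0\<close> by (simp add: \<gamma>'_def)
    have "((\<lambda>a. (\<Prod>i\<in>UNIV. h i + 2 * \<rho> / a) / \<gamma>') \<longlongrightarrow> (\<Prod>i\<in>UNIV. h i + 0) / \<gamma>') at_top"
      using \<open>\<gamma>' > 0\<close> by (intro tendsto_intros real_tendsto_divide_at_top[OF tendsto_const] filterlim_ident) auto
    then have vol: "\<forall>\<^sub>F a in at_top. (\<Prod>i\<in>UNIV. h i + 2 * \<rho> / a) / \<gamma>' < D / \<gamma> + \<eta>"
      using D\<gamma>' by (intro order_tendstoD) (auto simp: D_def)
    \<comment> \<open>An infinite \<open>S \<inter> Cb a\<close> would have \<open>ecard\<close>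
      equal to infinity, so this bound yields finiteness for large \<open>a\<close>.\<close>
    have "Limsup at_top ?dens < ereal (\<gamma> + 1)"
      using ic by (simp add: ic_density_def)
    then have fin: "\<forall>\<^sub>F a in at_top. ?dens a < ereal (\<gamma> + 1)"
      by (rule Limsup_lessD)
    have "\<not> (\<forall>\<^sub>F a in at_top. ?dens a \<le> ereal \<gamma>')"
      using Limsup_bounded[of ?dens "ereal \<gamma>'" at_top] ic \<open>\<gamma>' < \<gamma>\<close> by (auto simp: ic_density_def)
    then have "\<exists>\<^sub>F a in at_top. ereal \<gamma>' < ?dens a"
      by (simp add: frequently_def not_less)
    from frequently_ex[OF frequently_eventually_frequently[OF this
        eventually_conj[OF small eventually_conj[OF vol eventually_conj[OF fin eventually_gt_at_top[of 0]]]]]]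
    obtain a where a: "ereal \<gamma>' < ?dens a" "?avg a < ennreal (p - \<epsilon>)"
        "(\<Prod>i\<in>UNIV. h i + 2 * \<rho> / a) / \<gamma>' < D / \<gamma> + \<eta>" "?dens a < ereal (\<gamma> + 1)" "a > 0"
      by auto
    have finS: "finite (S \<inter> Cb a)"
      using a(4,5) by (auto simp: ecard_def split: if_splits)
    define A where "A = hmul h ` (S \<inter> Cb a)"
    have A: "received_IC h S \<inter> hmul h ` Cb a = A"
      using inj by (simp add: A_def received_IC_def image_Int)
    \<comment> \<open>Positive fading coefficients merge no points, so the density of
      \<open>S\<close> controls the number of received points.\<close>
    have "card A = card (S \<inter> Cb a)"
      unfolding A_def using inj by (intro card_image) (auto intro: inj_on_subset)
    then have card: "real (card A) > \<gamma>' * a ^ ?n"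
      using a(1,5) finS by (simp add: ecard_def field_simps)
    then have "real (card A) > 0" 
      using \<open>\<gamma>' > 0\<close> \<open>a > 0\<close> by (smt (verit) mult_pos_pos zero_less_power)
    \<comment> \<open>The box containing all truncated cells has at most volume
      \<open>D / \<gamma> + \<eta>\<close> per received point, because there are more than
      \<open>\<gamma>' * a ^ ?n\<close> points.\<close>
    have "(\<Prod>i\<in>UNIV. 2 * (h i * a / 2 + \<rho>)) = (\<Prod>i\<in>UNIV. a * (h i + 2 * \<rho> / a))"
      using \<open>a > 0\<close> by (intro prod.cong refl) (simp add: field_simps)
    also have "\<dots> = a ^ ?n * \<gamma>' * ((\<Prod>i\<in>UNIV. h i + 2 * \<rho> / a) / \<gamma>')"
      using \<open>\<gamma>' > 0\<close> by (simp add: prod.distrib)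
    also have "\<dots> \<le> a ^ ?n * \<gamma>' * (D / \<gamma> + \<eta>)"
      using a(3,5) \<open>\<gamma>' > 0\<close> by (intro mult_left_mono) auto
    also have "\<dots> \<le> real (card A) * (D / \<gamma> + \<eta>)"
      using card \<open>D / \<gamma> > 0\<close> \<open>\<eta> > 0\<close> by (intro mult_right_mono) (auto simp: mult.commute)
    finally have volA: "(\<Prod>i\<in>UNIV. 2 * (h i * a / 2 + \<rho>)) \<le> real (card A) * (D / \<gamma> + \<eta>)" .
    \<comment> \<open>Both halves of \<open>\<epsilon>\<close> are spent here. The term
      \<open>g * (D / \<gamma>)\<close> is added and subtracted to match the ball volume in
      \<open>sum_point_err_ge\<close>, by \<open>Rn\<close>.\<close>
    have "real (card A) * (p - \<epsilon>) \<le> real (card A) * (p - \<epsilon> / 2 - g * \<eta>)"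
      using g\<eta> by (intro mult_left_mono) auto
    also have "\<dots> = real (card A) * (p - \<epsilon> / 2 + g * (D / \<gamma>)) - g * (real (card A) * (D / \<gamma> + \<eta>))"
      by (simp add: algebra_simps)
    also have "\<dots> \<le> real (card A) * (p - measure (noise_meas \<sigma>) (- Cb (2 * \<rho>) :: ('n \<Rightarrow> real) set)
        + g * (D / \<gamma>)) - g * (\<Prod>i\<in>UNIV. 2 * (h i * a / 2 + \<rho>))"
      using volA \<rho> \<open>g \<ge> 0\<close> by (intro diff_mono mult_left_mono) auto
    also have "\<dots> \<le> (\<Sum>s\<in>A. point_err \<sigma> (received_IC h S) s)"
      unfolding p_def g_def Rn[symmetric]
    proof (rule sum_point_err_ge)
      show "countable (received_IC h S)" using assms by (simp add: received_IC_def)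
      show "A \<subseteq> received_IC h S" by (auto simp: A_def received_IC_def)
      show "finite A" using finS by (simp add: A_def)
      show "\<bar>s i\<bar> < h i * a / 2" if s: "s \<in> A" for s i
      proof -
        obtain x where x: "x \<in> Cb a" "s = hmul h x" using s by (auto simp: A_def)
        then have "\<bar>x i\<bar> < a / 2" unfolding Cb_def by blast
        then have "h i * \<bar>x i\<bar> < h i * (a / 2)" using assms(5)[of i] by (intro mult_strict_left_mono)
        then show ?thesis using x assms(5)[of i] by (simp add: hmul_def abs_mult)
      qed
      show "0 \<le> h i * a / 2" for i using assms(5)[of i] \<open>a > 0\<close> by simp
    qed fact+
    finally have "p - \<epsilon> \<le> (\<Sum>s\<in>A. point_err \<sigma> (received_IC h S) s) / real (card A)"
      using \<open>real (card A) > 0\<close> by (simp add: pos_le_divide_eq mult.commute)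
    then have "ennreal (p - \<epsilon>) \<le> ?avg a"
      by (simp add: A Let_def ennreal_leI)
    with a(2) show False by simp
  qed
  have "ennreal p \<le> cond_err \<sigma> S h"
  proof (rule ennreal_le_epsilon)
    fix \<epsilon> :: real assume "\<epsilon> > 0"
    \<comment> \<open>For \<open>p < \<epsilon>\<close> the first summand is 0, as
      \<open>ennreal\<close> maps negative reals to 0, and \<open>ennreal \<epsilon>\<close> alone
      suffices.\<close>
    have "ennreal p \<le> ennreal (p - \<epsilon>) + ennreal \<epsilon>"
      using \<open>\<epsilon> > 0\<close> ennreal_leI[of p \<epsilon>]
      by (cases "p \<ge> \<epsilon>") (simp_all add: ennreal_neg flip: ennreal_plus)
    also have "\<dots> \<le> cond_err \<sigma> S h + ennreal \<epsilon>"
      by (intro add_right_mono main) fact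
    finally show "ennreal p \<le> cond_err \<sigma> S h + ennreal \<epsilon>" .
  qed
  then show ?thesis
    unfolding D_def[symmetric] R2 by (simp add: p_def N.emeasure_eq_measure)
qed

section \<open>Averaging over the fading\<close>

lemma regular_fading_prob_space:
  assumes "regular_fading_pdf f"
  shows "prob_space (density lborel f)" "AE x in density lborel f. x > 0"
proof -
  have [measurable]: "f \<in> borel_measurable borel" and int: "(\<integral>\<^sup>+ h. ennreal (f h) \<partial>lborel) = 1"
    and neg: "\<And>x. x < 0 \<Longrightarrow> f x = 0"
    using assms by (auto simp: regular_fading_pdf_def)
  show "prob_space (density lborel f)"
    by (rule prob_spaceI) (simp add: emeasure_density int)
  \<comment> \<open>The density vanishes on the negative axis, so only the null set
    \<open>{0}\<close> remains to be excluded.\<close>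
  have "AE x in lborel. x \<noteq> (0::real)" by (rule AE_lborel_singleton)
  then show "AE x in density lborel f. x > 0"
    by (subst AE_density, measurable) (auto elim!: eventually_mono simp: neg linorder_neq_iff)
qed

theorem theorem4p2:
  fixes S :: "('n::finite \<Rightarrow> real) set" and \<sigma> \<delta> :: real and f :: "real \<Rightarrow> real"
  assumes "\<sigma> > 0"
    and "regular_fading_pdf f"
    and "countable S"
    and "0 < ic_density S" and "ic_density S < \<infinity>"
    and "NLD S = \<delta>"
  shows "emeasure (fading_meas f \<Otimes>\<^sub>M noise_meas \<sigma> :: (('n \<Rightarrow> real) \<times> ('n \<Rightarrow> real)) measure)
           {(h :: 'n \<Rightarrow> real, z :: 'n \<Rightarrow> real). sqnorm z \<ge> exp (-2 * \<delta>) *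
               ((\<Prod>i\<in>UNIV. h i) / V_ball CARD('n)) powr (2 / real CARD('n))}
         \<le> avg_err \<sigma> f S"
proof -
  interpret N: prob_space "noise_meas \<sigma> :: ('n \<Rightarrow> real) measure"
    by (rule prob_space_noise_meas) fact
  let ?thr = "\<lambda>h :: 'n \<Rightarrow> real. exp (-2 * \<delta>) *
               ((\<Prod>i\<in>UNIV. h i) / V_ball CARD('n)) powr (2 / real CARD('n))"
  have thr: "?thr \<in> borel_measurable lborel_PiM" by measurable
  have "{x \<in> space (lborel_PiM \<Otimes>\<^sub>M lborel_PiM :: (('n \<Rightarrow> real) \<times> ('n \<Rightarrow> real)) measure).
          ?thr (fst x) \<le> sqnorm (snd x)} \<in> sets (lborel_PiM \<Otimes>\<^sub>M lborel_PiM)"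
    by (intro borel_measurable_le measurable_compose[OF measurable_fst thr]
        measurable_compose[OF measurable_snd borel_measurable_sqnorm])
  then have meas: "{(h :: 'n \<Rightarrow> real, z :: 'n \<Rightarrow> real). sqnorm z \<ge> ?thr h} \<in> sets (fading_meas f \<Otimes>\<^sub>M noise_meas \<sigma>)"
    by (simp add: space_pair_measure case_prod_beta' cong: sets_pair_measure_cong)
  have pos: "AE h in fading_meas f. \<forall>i::'n. h i > 0"
    unfolding fading_meas_def AE_all_countable
    using regular_fading_prob_space[OF assms(2)] by (intro allI AE_PiM_component) auto
  \<comment> \<open>Independence of fading and noise is the product measure, so Fubini conditions on
    \<open>h\<close>; the pointwise bound then applies for almost every \<open>h\<close>, namely
    where all coefficients are positive.\<close>
  have "emeasure (fading_meas f \<Otimes>\<^sub>M noise_meas \<sigma>) {(h :: 'n \<Rightarrow> real, z :: 'n \<Rightarrow> real). sqnorm z \<ge> ?thr h}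
     = (\<integral>\<^sup>+ h. emeasure (noise_meas \<sigma>) {z :: 'n \<Rightarrow> real. sqnorm z \<ge> ?thr h} \<partial>fading_meas f)"
    unfolding N.emeasure_pair_measure_alt[OF meas] by (simp add: vimage_def)
  also have "\<dots> \<le> (\<integral>\<^sup>+ h. cond_err \<sigma> S h \<partial>fading_meas f)"
  proof (rule nn_integral_mono_AE)
    show "AE h in fading_meas f. emeasure (noise_meas \<sigma>) {z :: 'n \<Rightarrow> real. sqnorm z \<ge> ?thr h} \<le> cond_err \<sigma> S h"
      using pos
    proof eventually_elim
      case (elim h)
      then show ?case
        using cond_err_ge[OF assms(1,3,4,5), of h] by (simp only: assms(6))
    qed
  qed
  finally show ?thesis by (simp add: avg_err_def)
qed

end
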